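(* For every simple polytope $P\subset\mathbb{R}^d$ there is a perturbation $P'$ of $P$, combinatorially isomorphic to $P$, such that for any memory-less pivot rule there is a normalized-weight pivot rule (NW-rule) that produces the same arborescence as the given rule for $(P',c)$, for every generic objective function $c$.
   Context: For a polytope $P\subset\mathbb{R}^d$, $V(P)$ denotes its vertex set and $E(P)$ its edges. A $k$-dimensional polytope is simple if every vertex is incident to exactly $k$ edges. A perturbation of $P=\{x : Ax\le b\}$ is meant in the usual informal sense of a polytope obtained by slightly changing the defining data, e.g. $\{x : (A+\varepsilon A')x\le b\}$ for a matrix $A'$ and some $\varepsilon>0$. A linear function $c\in\mathbb{R}^d$ is generic for $P$ if $c^tu\neq c^tv$ for all edges $uv\in E(P)$; then $c$ has a unique maximizing vertex $v_{opt}$, and $(P,c)$ is called a linear program. For $v\in V(P)$, $\mathrm{Nb}_{P,c}(v)=\{u : uv\in E(P),\ c^tu>c^tv\}$ is the set of $c$-improving neighbors. A $c$-arborescence is a map $\mathcal{A}:V(P)\to V(P)$ with $\mathcal{A}(v)=v$ if and only if $v=v_{opt}$, and $\mathcal{A}(v)\in \mathrm{Nb}_{P,c}(v)$ for all $v\neq v_{opt}$. A pivot rule chooses, at each non-optimal vertex reached by the simplex method on $(P,c)$, a $c$-improving neighbor to move to. It is memory-less if, for every linear program $(P,c)$, the union of all $c$-monotone paths it produces (over all starting vertices) is a directed tree with root $v_{opt}$; equivalently, it is given by a choice of a $c$-arborescence for every linear program $(P,c)$, the arborescence it produces for $(P,c)$. An NW-rule is a choice, for every linear program $(P,c)$, of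 a normalization $\eta:\mathbb{R}^d\to\mathbb{R}$ and a weight $w\in\mathbb{R}^d$ (both may depend on $(P,c)$); the arborescence it produces for $(P,c)$ is the map fixing $v_{opt}$ and sending $v\neq v_{opt}$ to $$\operatorname{argmax}\left\{\frac{w^t(u-v)}{\eta(u-v)} : u\in \mathrm{Nb}_{P,c}(v)\right\}.$$ *)

theory Defs
  imports "HOL-Analysis.Analysis"
begin

definition vertices :: "(real^'n) set \<Rightarrow> (real^'n) set" where
  "vertices P = {v. v extreme_point_of P}"

(* The pair u, v spans an edge; u \<noteq> v is forced because an edge has affine dimension 1. *)
definition adjacent :: "(real^'n) set \<Rightarrow> real^'n \<Rightarrow> real^'n \<Rightarrow> bool" where
  "adjacent P u v \<longleftrightarrow> closed_segment u v edge_of P"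

(* Polytopes are nonempty by convention, as a linear program must have an optimum.
   A polytope need not be full-dimensional: its dimension is aff_dim P. *)
definition simple_polytope :: "(real^'n) set \<Rightarrow> bool" where
  "simple_polytope P \<longleftrightarrow> polytope P \<and> P \<noteq> {} \<and>
     (\<forall>v\<in>vertices P. int (card {e. e edge_of P \<and> v \<in> e}) = aff_dim P)"

(* Isomorphism of face lattices. *)
definition combinatorially_isomorphic :: "(real^'n) set \<Rightarrow> (real^'n) set \<Rightarrow> bool" where
  "combinatorially_isomorphic P Q \<longleftrightarrow>
     (\<exists>f. bij_betw f {F. F face_of P} {G. G face_of Q} \<and>
          (\<forall>F G. F face_of P \<longrightarrow> G face_of P \<longrightarrow> (F \<subseteq> G \<longleftrightarrow> f F \<subseteq> f G)))"

(* Q arises from {x. A *v x \<le> b} by a change of size less than \<delta> in the defining matrix;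
   the order on vectors is componentwise. *)
definition perturbation :: "real \<Rightarrow> real^'n^'m \<Rightarrow> real^'m \<Rightarrow> (real^'n) set \<Rightarrow> bool" where
  "perturbation \<delta> A b Q \<longleftrightarrow>
     (\<exists>A' \<epsilon>. \<epsilon> > 0 \<and> norm (\<epsilon> *\<^sub>R A') < \<delta> \<and> Q = {x. (A + \<epsilon> *\<^sub>R A') *v x \<le> b})"

definition generic :: "(real^'n) set \<Rightarrow> real^'n \<Rightarrow> bool" where
  "generic P c \<longleftrightarrow> (\<forall>u v. adjacent P u v \<longrightarrow> c \<bullet> u \<noteq> c \<bullet> v)"

definition linear_program :: "(real^'n) set \<Rightarrow> real^'n \<Rightarrow> bool" where
  "linear_program P c \<longleftrightarrow> polytope P \<and> P \<noteq> {} \<and> generic P c"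

(* Genericity makes the maximizing vertex unique, so THE is meaningful for linear programs. *)
definition v_opt :: "(real^'n) set \<Rightarrow> real^'n \<Rightarrow> real^'n" where
  "v_opt P c = (THE v. v \<in> vertices P \<and> (\<forall>u\<in>vertices P. c \<bullet> u \<le> c \<bullet> v))"

definition Nb :: "(real^'n) set \<Rightarrow> real^'n \<Rightarrow> real^'n \<Rightarrow> (real^'n) set" where
  "Nb P c v = {u. adjacent P u v \<and> c \<bullet> u > c \<bullet> v}"

(* Maps V(P) \<rightarrow> V(P) are total functions whose values outside the vertex set are irrelevant. *)
definition arborescence :: "(real^'n) set \<Rightarrow> real^'n \<Rightarrow> (real^'n \<Rightarrow> real^'n) \<Rightarrow> bool" where
  "arborescence P c \<A> \<longleftrightarrow>
     (\<forall>v\<in>vertices P. \<A> v \<in> vertices P \<and> (\<A> v = v \<longleftrightarrow> v = v_opt P c) \<and>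
        (v \<noteq> v_opt P c \<longrightarrow> \<A> v \<in> Nb P c v))"

(* A memory-less pivot rule is identified with the arborescences it produces. *)
definition memoryless_rule :: "((real^'n) set \<Rightarrow> real^'n \<Rightarrow> real^'n \<Rightarrow> real^'n) \<Rightarrow> bool" where
  "memoryless_rule R \<longleftrightarrow> (\<forall>P c. linear_program P c \<longrightarrow> arborescence P c (R P c))"

definition nw_score :: "(real^'n \<Rightarrow> real) \<Rightarrow> real^'n \<Rightarrow> real^'n \<Rightarrow> real^'n \<Rightarrow> real" where
  "nw_score \<eta> w v u = (w \<bullet> (u - v)) / \<eta> (u - v)"

(* The normalization \<eta> P c and the weight w P c may depend on the linear program.
   On every linear program the quotients must be defined (division by 0 is total in HOL)
   and the argmax must be a single vertex. *)
definition nw_rule ::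
  "((real^'n) set \<Rightarrow> real^'n \<Rightarrow> real^'n \<Rightarrow> real) \<Rightarrow> ((real^'n) set \<Rightarrow> real^'n \<Rightarrow> real^'n) \<Rightarrow> bool" where
  "nw_rule \<eta> w \<longleftrightarrow>
     (\<forall>P c. linear_program P c \<longrightarrow>
        (\<forall>v\<in>vertices P. v \<noteq> v_opt P c \<longrightarrow>
           (\<forall>u\<in>Nb P c v. \<eta> P c (u - v) \<noteq> 0) \<and>
           (\<exists>!u. is_arg_max (nw_score (\<eta> P c) (w P c) v) (\<lambda>u. u \<in> Nb P c v) u)))"

definition nw_arborescence ::
  "((real^'n) set \<Rightarrow> real^'n \<Rightarrow> real^'n \<Rightarrow> real) \<Rightarrow> ((real^'n) set \<Rightarrow> real^'n \<Rightarrow> real^'n)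
     \<Rightarrow> (real^'n) set \<Rightarrow> real^'n \<Rightarrow> real^'n \<Rightarrow> real^'n" where
  "nw_arborescence \<eta> w P c v =
     (if v = v_opt P c then v
      else arg_max (nw_score (\<eta> P c) (w P c) v) (\<lambda>u. u \<in> Nb P c v))"

end

theory Submission
  imports Defs
begin

text \<open>
  The projective map \<open>x \<mapsto> x / (1 + t \<bullet> x)\<close> carries \<open>{x. A x \<le> b}\<close> onto
  \<open>{y. (A + b t\<^sup>T) y \<le> b}\<close> when \<open>t\<close> is small, so its image is a perturbation of
  \<open>P\<close> with the same face lattice. For generic \<open>t\<close> the differences of two distinct vertices of
  the image are pairwise different. The normalization can then be prescribed independently
  on each directed edge, so with \<open>w = c\<close> every choice of improving neighbors maximizes some score.
\<close>

section \<open>Projective maps and their action on faces\<close>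

definition projective_map :: "'a::real_inner \<Rightarrow> 'a \<Rightarrow> 'a" where
  "projective_map t x = x /\<^sub>R (1 + t \<bullet> x)"

lemma projective_map_denominator:
  assumes "1 + t \<bullet> x > 0"
  shows "1 + (- t) \<bullet> projective_map t x = inverse (1 + t \<bullet> x)"
  using assms by (simp add: projective_map_def field_simps)

text \<open>Positivity passes to the image with \<open>- t\<close> in place of \<open>t\<close>, so
  each fact about \<open>projective_map t\<close> on \<open>S\<close> can be reapplied to the
  inverse map on the image.\<close>

lemma projective_map_denominator_pos:
  assumes "1 + t \<bullet> x > 0"
  shows "1 + (- t) \<bullet> projective_map t x > 0"
  unfolding projective_map_denominator[OF assms] using assms by (rule positive_imp_inverse_positive)

lemma projective_map_inverse:
  assumes "1 + t \<bullet> x > 0"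
  shows "projective_map (- t) (projective_map t x) = x"
proof -
  have "projective_map (- t) (projective_map t x)
      = projective_map t x /\<^sub>R (1 + (- t) \<bullet> projective_map t x)"
    by (simp add: projective_map_def)
  also have "\<dots> = x"
    unfolding projective_map_denominator[OF assms] using assms by (simp add: projective_map_def)
  finally show ?thesis .
qed

text \<open>The denominator is affine along the segment. The weights of the endpoints are therefore
  only multiplied by their denominators, giving \<open>p\<close> and \<open>q\<close>, and then
  renormalized by \<open>p + q\<close>.\<close>

lemma projective_map_open_segment:
  assumes a: "1 + t \<bullet> a > 0" and b: "1 + t \<bullet> b > 0" and x: "x \<in> open_segment a b"
  shows "projective_map t x \<in> open_segment (projective_map t a) (projective_map t b)"
proof -
  obtain u where u: "0 < u" "u < 1" "x = (1 - u) *\<^sub>R a + u *\<^sub>R b" and "a \<noteq> b"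
    using x by (auto simp: in_segment)
  define p where "p = (1 - u) * (1 + t \<bullet> a)"
  define q where "q = u * (1 + t \<bullet> b)"
  have pq: "p > 0" "q > 0" using u a b by (auto simp: p_def q_def)
  have den: "1 + t \<bullet> x = p + q"
    by (simp add: u p_def q_def inner_simps algebra_simps)
  have "projective_map t x = (1 - q / (p + q)) *\<^sub>R projective_map t a + (q / (p + q)) *\<^sub>R projective_map t b"
  proof -
    have "1 - q / (p + q) = p / (p + q)" using pq by (simp add: field_simps)
    moreover have "p * inverse (1 + t \<bullet> a) = 1 - u" "q * inverse (1 + t \<bullet> b) = u"
      using a b by (simp_all add: p_def q_def)
    ultimately have "(1 - q / (p + q)) * inverse (1 + t \<bullet> a) = inverse (p + q) * (1 - u)"
      "(q / (p + q)) * inverse (1 + t \<bullet> b) = inverse (p + q) * u"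
      by (metis (no_types) divide_inverse mult.assoc mult.commute)+
    then show ?thesis
      unfolding projective_map_def den by (simp add: u(3) scaleR_add_right)
  qed
  moreover have "projective_map t a \<noteq> projective_map t b"
    using projective_map_inverse[OF a] projective_map_inverse[OF b] \<open>a \<noteq> b\<close> by metis
  moreover have "0 < q / (p + q)" "q / (p + q) < 1" using pq by auto
  ultimately show ?thesis unfolding in_segment by blast
qed

text \<open>Convexity and the face condition can both be tested on open segments, and these are
  carried to open segments in both directions.\<close>

lemma projective_map_face_of:
  assumes S: "\<And>x. x \<in> S \<Longrightarrow> 1 + t \<bullet> x > 0" and T: "T face_of S"
  shows "projective_map t ` T face_of projective_map t ` S"
proof -
  have segment_back: "z \<in> open_segment (projective_map t a) (projective_map t b) \<Longrightarrow>
      projective_map (- t) z \<in> open_segment a b" if "a \<in> S" "b \<in> S" for a b z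
    using projective_map_open_segment[of "- t" "projective_map t a" "projective_map t b" z]
      projective_map_denominator_pos[OF S] projective_map_inverse[OF S] that by simp
  have TS: "T \<subseteq> S" and cT: "convex T" using T by (auto simp: face_of_def)
  have "convex (projective_map t ` T)"
    unfolding convex_contains_segment
  proof (intro ballI subsetI)
    fix y y' z assume y: "y \<in> projective_map t ` T" and y': "y' \<in> projective_map t ` T"
      and z: "z \<in> closed_segment y y'"
    show "z \<in> projective_map t ` T"
    proof (cases "z = y \<or> z = y'")
      case False
      obtain a a' where a: "a \<in> T" "y = projective_map t a" and a': "a' \<in> T" "y' = projective_map t a'"
        using y y' by blast
      have z: "z \<in> open_segment y y'" using z False by (simp add: open_segment_def)
      have "projective_map (- t) z \<in> open_segment a a'" using segment_back z a a' TS by blast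
      then have zT: "projective_map (- t) z \<in> T"
        using cT a(1) a'(1) convex_contains_open_segment by blast
      \<comment> \<open>The point \<open>z\<close> is not yet known to lie in the image. Its
        denominator for the inverse map is a convex combination of those at \<open>y\<close> and
        \<open>y'\<close>, hence positive, which permits mapping \<open>z\<close> back and
        forth.\<close>
      obtain k where k: "0 < k" "k < 1" "z = (1 - k) *\<^sub>R y + k *\<^sub>R y'"
        using z by (auto simp: in_segment)
      have "1 + (- t) \<bullet> y > 0" "1 + (- t) \<bullet> y' > 0"
        using projective_map_denominator_pos[OF S] a a' TS by blast+
      moreover have "1 + (- t) \<bullet> z = (1 - k) * (1 + (- t) \<bullet> y) + k * (1 + (- t) \<bullet> y')"
        unfolding k(3) by (simp add: inner_simps algebra_simps)
      ultimately have "1 + (- t) \<bullet> z > 0"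
        using k by (metis add_pos_pos diff_gt_0_iff_gt mult_pos_pos)
      from projective_map_inverse[OF this] zT show ?thesis by (metis image_eqI minus_minus)
    qed (use y y' in auto)
  qed
  moreover have "y \<in> projective_map t ` T \<and> y' \<in> projective_map t ` T"
    if "y \<in> projective_map t ` S" "y' \<in> projective_map t ` S" "z \<in> projective_map t ` T"
      "z \<in> open_segment y y'" for y y' z
  proof -
    obtain a a' x where a: "a \<in> S" "y = projective_map t a" "a' \<in> S" "y' = projective_map t a'"
      and x: "x \<in> T" "z = projective_map t x" using \<open>y \<in> _\<close> \<open>y' \<in> _\<close> \<open>z \<in> projective_map t ` T\<close> by blast
    have "x \<in> open_segment a a'"
      using segment_back[OF a(1,3), of z] that(4) a x TS projective_map_inverse[OF S, of x] by auto
    then have "a \<in> T" "a' \<in> T" using T a x unfolding face_of_def by blast+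
    then show ?thesis using a by blast
  qed
  ultimately show ?thesis using TS unfolding face_of_def by blast
qed

lemma projective_map_image_inverse:
  assumes "\<And>x. x \<in> S \<Longrightarrow> 1 + t \<bullet> x > 0" and "T \<subseteq> S"
  shows "projective_map (- t) ` projective_map t ` T = T"
proof -
  have "projective_map (- t) (projective_map t x) = x" if "x \<in> T" for x
    using assms that by (blast intro: projective_map_inverse)
  then show ?thesis by (force simp: image_image)
qed

text \<open>This is \<open>projective_map_face_of\<close> for the inverse map. It supplies
  surjectivity on faces for the isomorphism of face lattices.\<close>

lemma face_of_projective_map_image:
  assumes S: "\<And>x. x \<in> S \<Longrightarrow> 1 + t \<bullet> x > 0" and G: "G face_of projective_map t ` S"
  shows "projective_map (- t) ` G face_of S \<and> G = projective_map t ` projective_map (- t) ` G"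
proof -
  have pos: "1 + (- t) \<bullet> y > 0" if "y \<in> projective_map t ` S" for y
    using that projective_map_denominator_pos[OF S] by blast
  have "projective_map (- t) ` G face_of projective_map (- t) ` projective_map t ` S"
    using pos G by (rule projective_map_face_of)
  moreover have "projective_map (- (- t)) ` projective_map (- t) ` G = G"
    using pos face_of_imp_subset[OF G] by (rule projective_map_image_inverse)
  ultimately show ?thesis
    using projective_map_image_inverse[OF S subset_refl] by simp
qed

lemma combinatorially_isomorphic_projective_map:
  fixes S :: "(real^'n) set"
  assumes S: "\<And>x. x \<in> S \<Longrightarrow> 1 + t \<bullet> x > 0"
  shows "combinatorially_isomorphic S (projective_map t ` S)"
  unfolding combinatorially_isomorphic_def
proof (intro exI conjI allI impI)
  have inv: "projective_map (- t) ` projective_map t ` F = F" if "F face_of S" for F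
    using S face_of_imp_subset[OF that] by (rule projective_map_image_inverse)
  show "bij_betw ((`) (projective_map t)) {F. F face_of S} {G. G face_of projective_map t ` S}"
    by (rule bij_betw_byWitness[where f' = "(`) (projective_map (- t))"])
      (use inv projective_map_face_of[OF S] face_of_projective_map_image[OF S] in auto)
  show "F \<subseteq> G \<longleftrightarrow> projective_map t ` F \<subseteq> projective_map t ` G"
    if "F face_of S" "G face_of S" for F G
    using inv that by (metis image_mono)
qed

text \<open>Vertices are the singleton faces, and these pull back along the inverse map.\<close>

lemma vertices_projective_map:
  assumes S: "\<And>x. x \<in> S \<Longrightarrow> 1 + t \<bullet> x > 0"
  shows "vertices (projective_map t ` S) \<subseteq> projective_map t ` vertices S"
proof
  fix y assume "y \<in> vertices (projective_map t ` S)"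
  then have "{y} face_of projective_map t ` S"
    by (simp add: vertices_def face_of_singleton)
  then have "{projective_map (- t) y} face_of S" "y = projective_map t (projective_map (- t) y)"
    using face_of_projective_map_image[OF S] by fastforce+
  then show "y \<in> projective_map t ` vertices S"
    by (auto simp: vertices_def face_of_singleton)
qed

section \<open>The inequality description of the image\<close>

lemma polyhedron_matrix_le:
  fixes A :: "real^'n^'m"
  shows "polyhedron {x. A *v x \<le> b}"
proof -
  have "{x. A *v x \<le> b} = \<Inter> (range (\<lambda>i. {x. A $ i \<bullet> x \<le> b $ i}))"
    by (auto simp: less_eq_vec_def matrix_vector_mul_component)
  then show ?thesis
    by (auto intro!: polyhedron_Inter polyhedron_halfspace_le)
qed

text \<open>Such a \<open>z\<close> is a recession direction: the whole ray from \<open>x\<close>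
  along \<open>z\<close> stays feasible, which boundedness allows only for
  \<open>z = 0\<close>.\<close>

lemma bounded_recession_zero:
  fixes A :: "real^'n^'m"
  assumes "bounded {x. A *v x \<le> b}" and x: "A *v x \<le> b" and z: "A *v z \<le> 0"
  shows "z = 0"
proof (rule ccontr)
  assume "z \<noteq> 0"
  obtain B where B: "\<And>y. A *v y \<le> b \<Longrightarrow> norm y \<le> B"
    using assms(1) unfolding bounded_iff by auto
  \<comment> \<open>Chosen so that \<open>x + k *\<^sub>R z\<close> has norm at least
    \<open>\<bar>B\<bar> + 1\<close>.\<close>
  define k where "k = (\<bar>B\<bar> + norm x + 1) / norm z"
  have "k \<ge> 0" by (simp add: k_def)
  have "A *v (x + k *\<^sub>R z) \<le> b"
  proof -
    have "A *v (x + k *\<^sub>R z) = A *v x + k *\<^sub>R (A *v z)"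
      by (simp add: matrix_vector_right_distrib matrix_vector_mult_scaleR)
    moreover have "k *\<^sub>R (A *v z) \<le> 0"
      using z \<open>k \<ge> 0\<close> by (auto simp: less_eq_vec_def mult_nonneg_nonpos)
    ultimately show ?thesis using x add_mono by fastforce
  qed
  then have "norm (x + k *\<^sub>R z) \<le> B" by (rule B)
  moreover have "norm (k *\<^sub>R z) = \<bar>B\<bar> + norm x + 1"
    using \<open>z \<noteq> 0\<close> \<open>k \<ge> 0\<close> by (simp add: k_def)
  moreover have "norm (k *\<^sub>R z) \<le> norm (x + k *\<^sub>R z) + norm x"
    using norm_triangle_ineq4[of "x + k *\<^sub>R z" x] by simp
  ultimately show False by linarith
qed

text \<open>Dividing the constraints by \<open>1 + t \<bullet> x\<close> turns them into the new
  ones. Conversely, a solution \<open>y\<close> pulls back when \<open>t \<bullet> y < 1\<close>;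
  boundedness of the original polyhedron rules out solutions on the rest of the space.\<close>

lemma projective_map_polyhedron:
  fixes A :: "real^'n^'m"
  assumes bd: "bounded {x. A *v x \<le> b}" and ne: "{x. A *v x \<le> b} \<noteq> {}"
    and small: "\<And>x. A *v x \<le> b \<Longrightarrow> \<bar>t \<bullet> x\<bar> < 1"
  shows "projective_map t ` {x. A *v x \<le> b} = {y. A *v y + (t \<bullet> y) *\<^sub>R b \<le> b}"
proof (intro equalityI subsetI)
  fix y assume "y \<in> projective_map t ` {x. A *v x \<le> b}"
  then obtain x where x: "A *v x \<le> b" "y = projective_map t x" by blast
  define D where "D = 1 + t \<bullet> x"
  have D: "D > 0" using small[OF x(1)] by (simp add: D_def)
  have y: "y = inverse D *\<^sub>R x" by (simp add: x projective_map_def D_def)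
  have "A *v y + (t \<bullet> y) *\<^sub>R b \<le> b"
    unfolding less_eq_vec_def
  proof
    fix i
    have "(A *v x) $ i \<le> b $ i" using x by (simp add: less_eq_vec_def)
    then have "inverse D * ((A *v x) $ i + (t \<bullet> x) * b $ i) \<le> inverse D * (D * b $ i)"
      using D by (intro mult_left_mono) (auto simp: D_def distrib_right)
    also have "\<dots> = b $ i" using D by simp
    finally have "inverse D * ((A *v x) $ i + (t \<bullet> x) * b $ i) \<le> b $ i" .
    then show "(A *v y + (t \<bullet> y) *\<^sub>R b) $ i \<le> b $ i"
      by (simp add: y matrix_vector_mult_scaleR distrib_left mult.assoc)
  qed
  then show "y \<in> {y. A *v y + (t \<bullet> y) *\<^sub>R b \<le> b}" by simp
next
  fix y assume "y \<in> {y. A *v y + (t \<bullet> y) *\<^sub>R b \<le> b}"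
  then have le: "(A *v y) $ i \<le> (1 - t \<bullet> y) * b $ i" for i
    by (auto simp: less_eq_vec_def algebra_simps dest: spec[of _ i])
  obtain x0 where x0: "A *v x0 \<le> b" using ne by blast
  \<comment> \<open>The constraint reads
    \<open>A *v y \<le> (1 - t \<bullet> y) *\<^sub>R b\<close>, so the sign of the factor decides
    whether \<open>y\<close> rescales to a feasible point, is a recession direction, or satisfies
    reversed inequalities.\<close>
  consider "1 - t \<bullet> y > 0" | "1 - t \<bullet> y = 0" | "1 - t \<bullet> y < 0" by linarith
  then show "y \<in> projective_map t ` {x. A *v x \<le> b}"
  proof cases
    case 1
    then have pos: "1 + (- t) \<bullet> y > 0" by simp
    have "A *v projective_map (- t) y \<le> b"
      unfolding less_eq_vec_def
    proof
      fix i show "(A *v projective_map (- t) y) $ i \<le> b $ i"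
        using le[of i] 1
        by (simp add: projective_map_def matrix_vector_mult_scaleR field_simps)
    qed
    moreover have "y = projective_map t (projective_map (- t) y)"
      using projective_map_inverse[OF pos] by simp
    ultimately show ?thesis by blast
  next
    case 2
    then have "A *v y \<le> 0" using le by (simp add: less_eq_vec_def)
    then have "y = 0" by (rule bounded_recession_zero[OF bd x0])
    with 2 show ?thesis by simp
  next
    case 3
    define r where "r = t \<bullet> y - 1"
    have r: "r > 0" using 3 by (simp add: r_def)
    \<comment> \<open>After division by \<open>r\<close> the vector \<open>y\<close> satisfies the
      constraints with right-hand side \<open>- b\<close>. Adding the feasible \<open>x0\<close>
      cancels \<open>b\<close> and yields a recession direction; its vanishing forces
      \<open>t \<bullet> x0 = - (1 + r) / r < - 1\<close>, contrary to \<open>small\<close>.\<close>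
    have "A *v (x0 + y /\<^sub>R r) \<le> 0"
      unfolding less_eq_vec_def
    proof
      fix i
      have "(A *v y) $ i \<le> - r * b $ i" using le[of i] by (simp add: r_def)
      then have "inverse r * (A *v y) $ i \<le> - b $ i"
        using r by (simp add: field_simps)
      moreover have "(A *v x0) $ i \<le> b $ i" using x0 by (simp add: less_eq_vec_def)
      ultimately show "(A *v (x0 + y /\<^sub>R r)) $ i \<le> 0 $ i"
        by (simp add: matrix_vector_right_distrib matrix_vector_mult_scaleR)
    qed
    then have "x0 + y /\<^sub>R r = 0" by (rule bounded_recession_zero[OF bd x0])
    then have "t \<bullet> x0 + inverse r * (t \<bullet> y) = 0"
      by (metis inner_add_right inner_scaleR_right inner_zero_right)
    then have "t \<bullet> x0 = - (1 + r) / r" using r by (simp add: r_def field_simps)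
    with small[OF x0] r show ?thesis by (simp add: field_simps)
  qed
qed

section \<open>Generic directions and sets with distinct differences\<close>

text \<open>A suitable \<open>g\<close> avoids the finitely many hyperplanes orthogonal to
  differences of distinct points; their union has measure zero.\<close>

lemma exists_inner_inj_on:
  fixes V :: "'a::euclidean_space set"
  assumes "finite V"
  shows "\<exists>g. inj_on (\<lambda>x. g \<bullet> x) V"
proof -
  define D where "D = {x - y | x y. x \<in> V \<and> y \<in> V \<and> x \<noteq> y}"
  have "D \<subseteq> (\<lambda>(x, y). x - y) ` (V \<times> V)" by (auto simp: D_def)
  then have "finite D" using assms by (meson finite_SigmaI finite_imageI finite_subset)
  then have "negligible (\<Union>d\<in>D. {g. d \<bullet> g = 0})"
    by (intro negligible_Union) (auto simp: D_def intro!: negligible_hyperplane)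
  then obtain g where "g \<notin> (\<Union>d\<in>D. {g. d \<bullet> g = 0})"
    using non_negligible_UNIV by (metis UNIV_eq_I)
  then have g: "d \<bullet> g \<noteq> 0" if "d \<in> D" for d using that by blast
  have "inj_on (\<lambda>x. g \<bullet> x) V"
  proof (rule inj_onI, rule ccontr)
    fix x y assume "x \<in> V" "y \<in> V" "g \<bullet> x = g \<bullet> y" "x \<noteq> y"
    then have "x - y \<in> D" "(x - y) \<bullet> g = 0"
      by (auto simp: D_def inner_diff_left inner_commute[of _ g] inner_diff_right)
    with g show False by blast
  qed
  then show ?thesis ..
qed

text \<open>These are the Sidon sets of additive combinatorics. For a vertex set, an edge vector
  then determines its directed edge, although a normalization sees only the difference.\<close>

definition sidon :: "'a::ab_group_add set \<Rightarrow> bool" where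
  "sidon V \<longleftrightarrow> (\<forall>u\<in>V. \<forall>v\<in>V. \<forall>u'\<in>V. \<forall>v'\<in>V. u \<noteq> v \<longrightarrow> u - v = u' - v' \<longrightarrow> u = u' \<and> v = v')"

text \<open>The equation is the cross-multiplied equality of differences under the scalar map
  sending \<open>x\<close> to \<open>x / (1 + s * x)\<close>. It is polynomial in \<open>s\<close>
  of degree at most two. If it vanished identically, the constant coefficient would give equal
  differences and the linear one equal sums, so the two pairs would agree.\<close>

lemma finite_projective_coincidences:
  fixes a b a' b' :: real
  assumes "a \<noteq> b" and "(a, b) \<noteq> (a', b')"
  shows "finite {s. (a - b) * ((1 + s * a') * (1 + s * b')) = (a' - b') * ((1 + s * a) * (1 + s * b))}"
proof -
  define p where "p = [:(a - b) - (a' - b'), (a - b) * (a' + b') - (a' - b') * (a + b),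
    (a - b) * (a' * b') - (a' - b') * (a * b):]"
  have "p \<noteq> 0"
  proof
    assume "p = 0"
    then have 1: "a - b = a' - b'" and "(a - b) * (a' + b') = (a' - b') * (a + b)"
      by (auto simp: p_def)
    then have "a' + b' = a + b" using assms(1) by (metis eq_iff_diff_eq_0 mult_left_cancel)
    with 1 assms show False by auto
  qed
  then have "finite {s. poly p s = 0}" by (rule poly_roots_finite)
  then show ?thesis
    by (rule rev_finite_subset) (auto simp: p_def algebra_simps)
qed

lemma inner_projective_map_diff:
  assumes "1 + s * (g \<bullet> u) > 0" "1 + s * (g \<bullet> v) > 0"
  shows "g \<bullet> (projective_map (s *\<^sub>R g) u - projective_map (s *\<^sub>R g) v)
    = (g \<bullet> u - g \<bullet> v) / ((1 + s * (g \<bullet> u)) * (1 + s * (g \<bullet> v)))"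
proof -
  have "g \<bullet> (projective_map (s *\<^sub>R g) u - projective_map (s *\<^sub>R g) v)
      = (g \<bullet> u) / (1 + s * (g \<bullet> u)) - (g \<bullet> v) / (1 + s * (g \<bullet> v))"
    by (simp add: projective_map_def inner_diff_right divide_inverse mult.commute)
  also have "\<dots> = (g \<bullet> u - g \<bullet> v) / ((1 + s * (g \<bullet> u)) * (1 + s * (g \<bullet> v)))"
    using assms by (simp add: divide_simps) (simp add: algebra_simps)
  finally show ?thesis .
qed

text \<open>A failure of the Sidon property is already visible in the component along
  \<open>g\<close>, where it is a scalar coincidence. There are finitely many quadruples of points,
  and each is bad for only finitely many \<open>s\<close>.\<close>

lemma finite_not_sidon_projective_map:
  fixes V :: "'a::real_inner set"
  assumes fin: "finite V" and inj: "inj_on (\<lambda>x. g \<bullet> x) V"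
  shows "finite {s. (\<forall>x\<in>V. 1 + s * (g \<bullet> x) > 0) \<and> \<not> sidon (projective_map (s *\<^sub>R g) ` V)}"
    (is "finite ?B")
proof -
  define I where "I = {(u, v, u', v'). u \<in> V \<and> v \<in> V \<and> u' \<in> V \<and> v' \<in> V \<and> u \<noteq> v \<and> (u, v) \<noteq> (u', v')}"
  define C where "C = (\<lambda>(u, v, u', v'). {s. (g \<bullet> u - g \<bullet> v) * ((1 + s * (g \<bullet> u')) * (1 + s * (g \<bullet> v')))
    = (g \<bullet> u' - g \<bullet> v') * ((1 + s * (g \<bullet> u)) * (1 + s * (g \<bullet> v)))})"
  have "I \<subseteq> V \<times> V \<times> V \<times> V" by (auto simp: I_def)
  then have "finite I" using fin by (meson finite_SigmaI finite_subset)
  moreover have "finite (C i)" if "i \<in> I" for i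
  proof -
    obtain u v u' v' where i: "i = (u, v, u', v')" by (metis prod_cases4)
    have "g \<bullet> u \<noteq> g \<bullet> v" "(g \<bullet> u, g \<bullet> v) \<noteq> (g \<bullet> u', g \<bullet> v')"
      using that inj by (auto simp: I_def i inj_on_def)
    then show ?thesis unfolding C_def i prod.case by (rule finite_projective_coincidences)
  qed
  ultimately have "finite (\<Union>i\<in>I. C i)" by blast
  moreover have "?B \<subseteq> (\<Union>i\<in>I. C i)"
  proof
    fix s assume s: "s \<in> ?B"
    define f where "f = projective_map (s *\<^sub>R g)"
    obtain u v u' v' where V: "u \<in> V" "v \<in> V" "u' \<in> V" "v' \<in> V"
      and ne: "f u \<noteq> f v" "f u \<noteq> f u' \<or> f v \<noteq> f v'" and eq: "f u - f v = f u' - f v'"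
      using s unfolding sidon_def f_def by blast
    have pos: "1 + s * (g \<bullet> x) > 0" if "x \<in> V" for x using s that by blast
    have "g \<bullet> (f u - f v) = g \<bullet> (f u' - f v')" by (simp add: eq)
    then have "(g \<bullet> u - g \<bullet> v) / ((1 + s * (g \<bullet> u)) * (1 + s * (g \<bullet> v)))
        = (g \<bullet> u' - g \<bullet> v') / ((1 + s * (g \<bullet> u')) * (1 + s * (g \<bullet> v')))"
      using V pos unfolding f_def by (simp add: inner_projective_map_diff)
    moreover have "(1 + s * (g \<bullet> u)) * (1 + s * (g \<bullet> v)) \<noteq> 0"
      "(1 + s * (g \<bullet> u')) * (1 + s * (g \<bullet> v')) \<noteq> 0"
      using pos[OF V(1)] pos[OF V(2)] pos[OF V(3)] pos[OF V(4)] by auto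
    ultimately have "s \<in> C (u, v, u', v')"
      unfolding C_def prod.case mem_Collect_eq using frac_eq_eq by blast
    moreover have "(u, v, u', v') \<in> I" using V ne by (auto simp: I_def)
    ultimately show "s \<in> (\<Union>i\<in>I. C i)" by blast
  qed
  ultimately show ?thesis by (rule rev_finite_subset)
qed

section \<open>Realizing arborescences by normalized weights\<close>

lemma finite_vertices: "polytope P \<Longrightarrow> finite (vertices P)"
  unfolding vertices_def
  by (intro finite_polyhedron_extreme_points polytope_imp_polyhedron)

lemma adjacent_vertices:
  assumes "adjacent P u v"
  shows "u \<in> vertices P" "v \<in> vertices P"
proof -
  have "closed_segment u v face_of P" using assms by (simp add: adjacent_def edge_of_def)
  then show "u \<in> vertices P" "v \<in> vertices P"
    using extreme_point_of_face extreme_point_of_segment unfolding vertices_def by blast+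
qed

lemma Nb_subset_vertices: "Nb P c v \<subseteq> vertices P"
  using adjacent_vertices by (auto simp: Nb_def)

lemma ex1_is_arg_max_inj_on:
  fixes f :: "'a \<Rightarrow> 'b::linorder"
  assumes "finite N" "N \<noteq> {}" "inj_on f N"
  shows "\<exists>!u. is_arg_max f (\<lambda>u. u \<in> N) u"
proof -
  have "Max (f ` N) \<in> f ` N" using assms by simp
  then obtain u where u: "u \<in> N" "Max (f ` N) = f u" by auto
  show ?thesis
  proof (intro ex1I)
    show "is_arg_max f (\<lambda>u. u \<in> N) u"
      using assms u by (metis Max_ge finite_imageI imageI is_arg_max_linorder)
    fix v assume "is_arg_max f (\<lambda>u. u \<in> N) v"
    then have "v \<in> N" "f u \<le> f v" using u by (auto simp: is_arg_max_linorder)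
    moreover have "f v \<le> f u" using assms u \<open>v \<in> N\<close> by (metis Max_ge finite_imageI imageI)
    ultimately show "v = u" using assms(3) u(1) by (simp add: inj_on_def)
  qed
qed

lemma nw_rule_realizes_arborescences:
  fixes Q :: "(real^'n) set"
  assumes Q: "polytope Q" "Q \<noteq> {}" and sidon: "sidon (vertices Q)" and R: "memoryless_rule R"
  shows "\<exists>\<eta> w. nw_rule \<eta> w \<and>
    (\<forall>c. generic Q c \<longrightarrow> (\<forall>v\<in>vertices Q. nw_arborescence \<eta> w Q c v = R Q c v))"
proof -
  have arb: "R P c v \<in> Nb P c v"
    if "linear_program P c" "v \<in> vertices P" "v \<noteq> v_opt P c" for P c v
    using R that by (simp add: memoryless_rule_def arborescence_def)
  \<comment> \<open>The weights \<open>W P\<close> serve the linear programs on polytopes other than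
    \<open>Q\<close>: with constant normalization 1, distinct values on the vertices make the argmax
    unique.\<close>
  obtain W where W: "polytope P \<Longrightarrow> inj_on (\<lambda>x. W P \<bullet> x) (vertices P)" for P :: "(real^'n) set"
    using exists_inner_inj_on[OF finite_vertices] by metis
  \<comment> \<open>On \<open>Q\<close> the weight is \<open>c\<close> itself, so the chosen
    improving edge scores 1 and every other one scores 1/2.\<close>
  define \<eta> where "\<eta> = (\<lambda>P c d. if P = Q
    then if \<exists>v\<in>vertices P. d = R P c v - v then c \<bullet> d else 2 * (c \<bullet> d) else 1)"
  define w where "w = (\<lambda>P c. if P = Q then c else W P)"
  have score: "nw_score (\<eta> Q c) (w Q c) v u = (if u = R Q c v then 1 else 1 / 2)"
    if lp: "linear_program Q c" and v: "v \<in> vertices Q" "v \<noteq> v_opt Q c" and u: "u \<in> Nb Q c v" for c v u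
  proof -
    have pos: "c \<bullet> (u - v) > 0" using u by (simp add: Nb_def inner_diff_right)
    \<comment> \<open>The test in \<open>\<eta>\<close> ranges over all tails \<open>v'\<close>, so
      an edge at \<open>v\<close> might match a choice made elsewhere. The Sidon property excludes
      this; at the optimum the chosen difference is zero, which never equals
      \<open>u - v\<close>.\<close>
    have "u = R Q c v" if "v' \<in> vertices Q" "u - v = R Q c v' - v'" for v'
    proof -
      have "R Q c v' \<in> vertices Q" using R lp that(1) by (simp add: memoryless_rule_def arborescence_def)
      moreover have "u \<in> vertices Q" "u \<noteq> v" using u Nb_subset_vertices pos by auto
      ultimately show ?thesis using sidon v that unfolding sidon_def by blast
    qed
    then have "(\<exists>v'\<in>vertices Q. u - v = R Q c v' - v') \<longleftrightarrow> u = R Q c v"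
      using v by blast
    then have "\<eta> Q c (u - v) = (if u = R Q c v then c \<bullet> (u - v) else 2 * (c \<bullet> (u - v)))"
      unfolding \<eta>_def by simp
    then show ?thesis using pos by (auto simp: nw_score_def w_def)
  qed
  have max_iff: "is_arg_max (nw_score (\<eta> Q c) (w Q c) v) (\<lambda>u. u \<in> Nb Q c v) u \<longleftrightarrow> u = R Q c v"
    if "linear_program Q c" "v \<in> vertices Q" "v \<noteq> v_opt Q c" for c v u
    using arb[OF that] score[OF that] by (auto simp: is_arg_max_linorder split: if_splits)
  have "nw_rule \<eta> w"
    unfolding nw_rule_def
  proof (intro allI impI ballI)
    fix P :: "(real^'n) set" and c v
    assume lp: "linear_program P c" and v: "v \<in> vertices P" "v \<noteq> v_opt P c"
    show "(\<forall>u\<in>Nb P c v. \<eta> P c (u - v) \<noteq> 0) \<and>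
      (\<exists>!u. is_arg_max (nw_score (\<eta> P c) (w P c) v) (\<lambda>u. u \<in> Nb P c v) u)"
    proof (cases "P = Q")
      case True
      have "\<eta> Q c (u - v) \<noteq> 0" if "u \<in> Nb Q c v" for u
        using that by (auto simp: \<eta>_def Nb_def inner_diff_right)
      then show ?thesis using max_iff lp v True by auto
    next
      case False
      have P: "polytope P" using lp by (simp add: linear_program_def)
      have "inj_on (nw_score (\<eta> P c) (w P c) v) (Nb P c v)"
        using W[OF P] Nb_subset_vertices[of P c v] False
        by (auto simp: inj_on_def nw_score_def \<eta>_def w_def inner_diff_right)
      moreover have "finite (Nb P c v)"
        using Nb_subset_vertices finite_vertices[OF P] by (rule finite_subset)
      \<comment> \<open>The given rule itself witnesses that a non-optimal vertex has an improving
        neighbor.\<close>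
      moreover have "Nb P c v \<noteq> {}" using arb[OF lp v] by blast
      ultimately have "\<exists>!u. is_arg_max (nw_score (\<eta> P c) (w P c) v) (\<lambda>u. u \<in> Nb P c v) u"
        by (intro ex1_is_arg_max_inj_on)
      then show ?thesis using False by (simp add: \<eta>_def)
    qed
  qed
  moreover have "nw_arborescence \<eta> w Q c v = R Q c v" if "generic Q c" and v: "v \<in> vertices Q" for c v
  proof -
    have lp: "linear_program Q c" using Q that by (simp add: linear_program_def)
    show ?thesis
    proof (cases "v = v_opt Q c")
      case True
      have "R Q c v = v \<longleftrightarrow> v = v_opt Q c"
        using R lp v unfolding memoryless_rule_def arborescence_def by blast
      then show ?thesis using True by (simp add: nw_arborescence_def)
    next
      case False
      then show ?thesis
        by (simp add: nw_arborescence_def arg_max_def max_iff[OF lp v])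
    qed
  qed
  ultimately show ?thesis by blast
qed

section \<open>Choice of the perturbation and conclusion\<close>

text \<open>The norm and denominator conditions hold for all small positive \<open>s\<close>. That
  leaves an interval of candidates, of which only finitely many violate the Sidon property.\<close>

lemma exists_sidon_projective_map:
  fixes P :: "(real^'n) set" and b :: "real^'m"
  assumes P: "polytope P" and "\<delta> > 0"
  shows "\<exists>g s. s > 0 \<and> norm (s *\<^sub>R (\<chi> i j. b $ i * g $ j)) < \<delta> \<and>
    (\<forall>x\<in>P. \<bar>(s *\<^sub>R g) \<bullet> x\<bar> < 1) \<and> sidon (vertices (projective_map (s *\<^sub>R g) ` P))"
proof -
  obtain g where g: "inj_on (\<lambda>x. g \<bullet> x) (vertices P)"
    using exists_inner_inj_on[OF finite_vertices[OF P]] by blast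
  define A' where "A' = (\<chi> i j. b $ i * g $ j)"
  obtain B where B: "B > 0" "\<And>x. x \<in> P \<Longrightarrow> norm x \<le> B"
    using polytope_imp_bounded[OF P] unfolding bounded_pos by blast
  \<comment> \<open>The first bound keeps the matrix change below \<open>\<delta>\<close>; the
    second gives \<open>\<bar>(s *\<^sub>R g) \<bullet> x\<bar> < 1\<close> on \<open>P\<close> by
    Cauchy-Schwarz. The summands 1 keep the divisors positive.\<close>
  define s0 where "s0 = min (\<delta> / (norm A' + 1)) (1 / (norm g * B + 1))"
  have nonneg: "norm g * B \<ge> 0" using B by simp
  then have "s0 > 0" using \<open>\<delta> > 0\<close> by (simp add: s0_def add_nonneg_pos)
  then have "infinite {0<..<s0}" by (simp add: infinite_Ioo)
  then obtain s where s: "s \<in> {0<..<s0}"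
    and good: "s \<notin> {s. (\<forall>x\<in>vertices P. 1 + s * (g \<bullet> x) > 0) \<and> \<not> sidon (projective_map (s *\<^sub>R g) ` vertices P)}"
    using finite_not_sidon_projective_map[OF finite_vertices[OF P] g] by (meson finite_subset subsetI)
  have s': "s > 0" "s * (norm A' + 1) < \<delta>" "s * (norm g * B + 1) < 1"
    using s nonneg by (auto simp: s0_def pos_less_divide_eq add_nonneg_pos)
  have small: "\<bar>(s *\<^sub>R g) \<bullet> x\<bar> < 1" if "x \<in> P" for x
  proof -
    have "\<bar>g \<bullet> x\<bar> \<le> norm g * norm x" by (rule Cauchy_Schwarz_ineq2)
    also have "\<dots> \<le> norm g * B" using B that by (intro mult_left_mono) auto
    finally have "s * \<bar>g \<bullet> x\<bar> \<le> s * (norm g * B)" using s' by simp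
    also have "\<dots> < 1" using s' by (simp add: distrib_left)
    finally show ?thesis using s' by (simp add: abs_mult)
  qed
  then have pos: "1 + (s *\<^sub>R g) \<bullet> x > 0" if "x \<in> P" for x using that by (smt (verit))
  have "vertices P \<subseteq> P" by (auto simp: vertices_def extreme_point_of_def)
  then have "sidon (projective_map (s *\<^sub>R g) ` vertices P)"
    using good pos by auto
  \<comment> \<open>The Sidon property passes to subsets.\<close>
  then have "sidon (vertices (projective_map (s *\<^sub>R g) ` P))"
    using vertices_projective_map[OF pos] unfolding sidon_def by (meson subsetD)
  moreover have "norm (s *\<^sub>R A') < \<delta>" using s' by (simp add: algebra_simps)
  ultimately show ?thesis using s'(1) small unfolding A'_def by blast
qed

theorem theorem1p2:
  fixes P :: "(real^'n) set" and A :: "real^'n^'m" and b :: "real^'m" and \<delta> :: real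
  assumes "simple_polytope P" and "P = {x. A *v x \<le> b}" and "\<delta> > 0"
  shows "\<exists>P'. perturbation \<delta> A b P' \<and> polytope P' \<and> combinatorially_isomorphic P P' \<and>
           (\<forall>R. memoryless_rule R \<longrightarrow>
              (\<exists>\<eta> w. nw_rule \<eta> w \<and>
                 (\<forall>c. generic P' c \<longrightarrow>
                    (\<forall>v\<in>vertices P'. nw_arborescence \<eta> w P' c v = R P' c v))))"
proof -
  have P: "polytope P" "P \<noteq> {}" using assms(1) by (auto simp: simple_polytope_def)
  obtain g s where s: "s > 0" "norm (s *\<^sub>R (\<chi> i j. b $ i * g $ j)) < \<delta>"
    and small: "\<And>x. x \<in> P \<Longrightarrow> \<bar>(s *\<^sub>R g) \<bullet> x\<bar> < 1"
    and sidon: "sidon (vertices (projective_map (s *\<^sub>R g) ` P))"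
    using exists_sidon_projective_map[OF P(1) \<open>\<delta> > 0\<close>] by blast
  define A' where "A' = (\<chi> i j. b $ i * g $ j)"
  define P' where "P' = projective_map (s *\<^sub>R g) ` P"
  have pos: "1 + (s *\<^sub>R g) \<bullet> x > 0" if "x \<in> P" for x
    using small[OF that] by (smt (verit))
  have "P' = {y. A *v y + ((s *\<^sub>R g) \<bullet> y) *\<^sub>R b \<le> b}"
    unfolding P'_def assms(2)
    by (rule projective_map_polyhedron) (use P small polytope_imp_bounded assms(2) in auto)
  \<comment> \<open>The additional term is the rank-one matrix with entries
    \<open>b $ i * g $ j\<close>, scaled by \<open>s\<close> and applied to \<open>y\<close>; thus
    \<open>s\<close> takes the role of the perturbation size \<open>\<epsilon>\<close>.\<close>
  moreover have "A *v y + ((s *\<^sub>R g) \<bullet> y) *\<^sub>R b = (A + s *\<^sub>R A') *v y" for y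
    by (simp add: vec_eq_iff A'_def matrix_vector_mult_def inner_vec_def sum.distrib
        distrib_left sum_distrib_left mult_ac)
  ultimately have P': "P' = {y. (A + s *\<^sub>R A') *v y \<le> b}" by simp
  have "perturbation \<delta> A b P'"
    unfolding perturbation_def using s P' unfolding A'_def by blast
  moreover have "polytope P'"
  proof -
    \<comment> \<open>Boundedness of \<open>P'\<close> comes from its being a continuous image of a
      compact set, and polyhedrality from its inequality description.\<close>
    have "compact P'"
      unfolding P'_def projective_map_def
      by (intro compact_continuous_image polytope_imp_compact P continuous_intros ballI)
        (use pos in force)
    then show ?thesis
      unfolding polytope_eq_bounded_polyhedron using P' polyhedron_matrix_le compact_imp_bounded by auto
  qed
  moreover have "combinatorially_isomorphic P P'"
    unfolding P'_def using pos by (rule combinatorially_isomorphic_projective_map)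
  moreover have "P' \<noteq> {}" using P by (simp add: P'_def)
  ultimately show ?thesis using nw_rule_realizes_arborescences sidon unfolding P'_def by blast
qed

end
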